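(* Suppose that the parameters $p_1,\dots,p_5$ are such that nonlinear synchronization occurs (for the positive time direction). Let $p_\infty\in S^2$ be the asymptotically stable fixed point given by the definition of nonlinear synchronization for the flow of (Q) with $\rho=1$, and let $\mathfrak{P}=\{p_n\}_{n=1}^N\subset S^2$ be the set of the other fixed points of (Q) with $\rho=1$. Then there exists a pair $(\gamma_1,\gamma_2)\in\mathbb{C}^2\setminus\{(0,0)\}$ such that, for every small-data global solution $(u_1,u_2)$ of (NLS) and associated functions $(\alpha_1^+,\alpha_2^+)$ as described in the context, and for any closed subset $\mathfrak{E}$ of $S^2$ contained in $S^2\setminus\mathfrak{P}$, $$t^{\frac12}\,\big\|(\gamma_1u_1+\gamma_2u_2)(t,2t\,\cdot)\big\|_{L^\infty(\Omega(\mathfrak{E}))}\to0\qquad\text{as } t\to\infty,$$ where $$\Omega(\mathfrak{E})=\Big\{\xi\in\mathbb{R}\ :\ \big(|\alpha_1^+(\xi)|^2-|\alpha_2^+(\xi)|^2,\ 2\operatorname{Re}\overline{\alpha_1^+(\xi)}\alpha_2^+(\xi),\ 2\operatorname{Im}\overline{\alpha_1^+(\xi)}\alpha_2^+(\xi)\big)\in\{k e: e\in \mathfrak{E},\ k\ge0\}\Big\}.$$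
   Context: Parameters: $p_1\ge0$, $p_2\in\mathbb{R}$, $p_3\ge0$, $p_4\in\mathbb{R}$, $p_5\ge0$, not all zero; $q_1,q_2,q_3\in\mathbb{R}$. (NLS): $(i\partial_t+\partial_x^2)u_j=F_j(u_1,u_2)$, $(t,x)\in\mathbb{R}\times\mathbb{R}$, $j=1,2$, with $$F_1=(3p_2+p_3+2p_4)|u_1|^2u_1+(p_1+p_5)(2|u_1|^2u_2+u_1^2\overline{u_2})+(p_2-p_3)(2u_1|u_2|^2+\overline{u_1}u_2^2)-(p_1-p_5)|u_2|^2u_2-4p_1\operatorname{Re}(\overline{u_1}u_2)u_1+\mathcal{V}u_1,$$ $$F_2=(p_1+p_5)|u_1|^2u_1+(p_2-p_3)(2|u_1|^2u_2+u_1^2\overline{u_2})-(p_1-p_5)(2u_1|u_2|^2+\overline{u_1}u_2^2)+(3p_2+p_3-2p_4)|u_2|^2u_2+4p_1\operatorname{Re}(\overline{u_1}u_2)u_2+\mathcal{V}u_2,$$ $\mathcal{V}=q_1|u_1|^2+2q_2\operatorname{Re}(\overline{u_1}u_2)+q_3|u_2|^2$; the initial data are $(u_1,u_2)(0)=(u_{0,1},u_{0,2})\in H^{3,1}(\mathbb{R})^2$, where $\|f\|_{H^{s,k}}=\sum_{\sigma=0}^k\|\langle x\rangle^\sigma f\|_{H^{s-\sigma}}$, $\langle x\rangle=(1+x^2)^{1/2}$. Small-data solutions (known result of Katayama and Sakoda): there is $\delta_0\in(0,1/4)$ such that for any $\delta\in(0,\delta_0)$ there is $\varepsilon_0>0$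 such that if $\varepsilon:=\|u_{0,1}\|_{H^{3,1}}+\|u_{0,2}\|_{H^{3,1}}<\varepsilon_0$, then (NLS) with these data has a unique global solution $(u_1,u_2)\in C(\mathbb{R},H^{3,1})^2$ and there exist $(\alpha_1^+,\alpha_2^+)\in L^\infty\cap H^{0,1}$ with $|\alpha_1^+(\xi)|+|\alpha_2^+(\xi)|\lesssim\langle\xi\rangle^{-2}$ such that, for $\beta\le2$, as $t\to\infty$, $$\partial_x^\beta u_j(t,x)=\Big(\frac{ix}{2t}\Big)^\beta(2it)^{-\frac12}e^{i\frac{x^2}{4t}}A_j^+\Big(\tfrac12\log t,\tfrac{x}{2t}\Big)+O(\varepsilon t^{-\frac34+\delta})\quad\text{in }L^\infty_x(\mathbb{R}),$$ where for each $\xi$, $\tau\mapsto(A_1^+(\tau,\xi),A_2^+(\tau,\xi))$ solves $iA_1'=F_1(A_1,A_2)$, $iA_2'=F_2(A_1,A_2)$ with value $(\alpha_1^+(\xi),\alpha_2^+(\xi))$ at $\tau=0$. "Small-data global solution with associated functions $(\alpha_1^+,\alpha_2^+)$" means such a solution together with such functions. (Q): for $\rho>0$, the flow on $S^2_\rho=\{(x,y,z)\in\mathbb{R}^3: x^2+y^2+z^2=\rho^2\}$ (with $S^2=S_1^2$) given by $$\mathcal{D}'=2\mathcal{I}(p_1\mathcal{D}+(p_2-p_3)\mathcal{R})+2\rho p_5\mathcal{I},\quad \mathcal{R}'=2\mathcal{I}(-(p_2+p_3)\mathcal{D}+p_1\mathcal{R})-2\rho p_4\mathcal{I},$$ $$\mathcal{I}'=-2p_1(\mathcal{D}^2+\mathcal{R}^2)+4p_3\mathcal{D}\mathcal{R}+2\rho(-p_5\mathcal{D}+p_4\mathcal{R}).$$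 Nonlinear synchronization (positive time direction) occurs if this flow on $S^2_\rho$ has finitely many fixed points and there is an asymptotically stable fixed point $p_\infty$ such that: (1) (strong attraction) $\omega(x_0)=\{p_\infty\}$ for every non-equilibrium $x_0\in S^2_\rho$, where $\omega(x_0)$ is the set of $\omega$-limit points of $x_0$; (2) (Lyapunov stability) for any open neighborhood $U\subset S^2_\rho$ of $p_\infty$ there is an open neighborhood $V\subset S^2_\rho$ of $p_\infty$ such that $(\mathcal{D}(0),\mathcal{R}(0),\mathcal{I}(0))\in V$ implies $(\mathcal{D}(\tau),\mathcal{R}(\tau),\mathcal{I}(\tau))\in U$ for all $\tau\ge0$. By scaling, this property does not depend on $\rho>0$. *)

theory Defs
  imports "HOL-Analysis.Analysis" "HOL-Probability.Essential_Supremum"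
begin

text \<open>
  The parameters are vectors \<open>p :: real^5\<close> and \<open>q :: real^3\<close>, with \<open>p $ k\<close> for $p_k$ and
  \<open>q $ k\<close> for $q_k$. A point $(\mathcal{D},\mathcal{R},\mathcal{I})$ is a vector
  \<open>v :: real^3\<close>, and $S^2_\rho$ is \<open>sphere 0 \<rho>\<close>.
\<close>

section \<open>The nonlinear Schroedinger system\<close>

definition NLS_V :: "real^3 \<Rightarrow> complex \<Rightarrow> complex \<Rightarrow> real" where
  "NLS_V q a b = q$1 * (cmod a)\<^sup>2 + 2 * q$2 * Re (cnj a * b) + q$3 * (cmod b)\<^sup>2"

definition NLS_F1 :: "real^5 \<Rightarrow> real^3 \<Rightarrow> complex \<Rightarrow> complex \<Rightarrow> complex" where
  "NLS_F1 p q a b =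
      of_real ((3 * p$2 + p$3 + 2 * p$4) * (cmod a)\<^sup>2) * a
    + of_real (p$1 + p$5) * (2 * of_real ((cmod a)\<^sup>2) * b + a\<^sup>2 * cnj b)
    + of_real (p$2 - p$3) * (2 * a * of_real ((cmod b)\<^sup>2) + cnj a * b\<^sup>2)
    - of_real ((p$1 - p$5) * (cmod b)\<^sup>2) * b
    - of_real (4 * p$1 * Re (cnj a * b)) * a
    + of_real (NLS_V q a b) * a"

definition NLS_F2 :: "real^5 \<Rightarrow> real^3 \<Rightarrow> complex \<Rightarrow> complex \<Rightarrow> complex" where
  "NLS_F2 p q a b =
      of_real ((p$1 + p$5) * (cmod a)\<^sup>2) * a
    + of_real (p$2 - p$3) * (2 * of_real ((cmod a)\<^sup>2) * b + a\<^sup>2 * cnj b)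
    - of_real (p$1 - p$5) * (2 * a * of_real ((cmod b)\<^sup>2) + cnj a * b\<^sup>2)
    + of_real ((3 * p$2 + p$3 - 2 * p$4) * (cmod b)\<^sup>2) * b
    + of_real (4 * p$1 * Re (cnj a * b)) * b
    + of_real (NLS_V q a b) * b"

definition dx :: "(real \<Rightarrow> complex) \<Rightarrow> real \<Rightarrow> complex" where
  "dx f = (\<lambda>x. vector_derivative f (at x))"

text \<open>
  A solution in $C(\mathbb{R}, H^{3,1})$ has $u_j \in C(\mathbb{R}, C^2)$ and
  $\partial_t u_j \in C(\mathbb{R}, H^1)$, so its continuous representative satisfies the
  system classically. Functions \<open>u t x\<close> below are this representative.
\<close>

definition solves_NLS ::
  "real^5 \<Rightarrow> real^3 \<Rightarrow> (real \<Rightarrow> real \<Rightarrow> complex) \<Rightarrow> (real \<Rightarrow> real \<Rightarrow> complex) \<Rightarrow> bool" where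
  "solves_NLS p q u1 u2 \<longleftrightarrow>
    (\<forall>t x.
      (\<forall>u\<in>{u1, u2}. u t differentiable at x \<and> dx (u t) differentiable at x \<and>
                    (\<lambda>s. u s x) differentiable at t) \<and>
      \<i> * vector_derivative (\<lambda>s. u1 s x) (at t) + dx (dx (u1 t)) x = NLS_F1 p q (u1 t x) (u2 t x) \<and>
      \<i> * vector_derivative (\<lambda>s. u2 s x) (at t) + dx (dx (u2 t)) x = NLS_F2 p q (u1 t x) (u2 t x))"


section \<open>Function spaces\<close>

definition Linf_norm :: "real set \<Rightarrow> (real \<Rightarrow> complex) \<Rightarrow> ennreal" where
  "Linf_norm S f = esssup (restrict_space lebesgue S) (\<lambda>x. ennreal (norm (f x)))"

definition in_Linf :: "(real \<Rightarrow> complex) \<Rightarrow> bool" where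
  "in_Linf f \<longleftrightarrow> f \<in> borel_measurable lebesgue \<and> Linf_norm UNIV f < \<infinity>"

definition in_L2 :: "(real \<Rightarrow> complex) \<Rightarrow> bool" where
  "in_L2 f \<longleftrightarrow> f \<in> borel_measurable lebesgue \<and> integrable lebesgue (\<lambda>x. (norm (f x))\<^sup>2)"

definition L2_nrm :: "(real \<Rightarrow> complex) \<Rightarrow> real" where
  "L2_nrm f = sqrt (LINT x|lebesgue. (norm (f x))\<^sup>2)"

definition test_fun :: "(real \<Rightarrow> complex) \<Rightarrow> bool" where
  "test_fun \<phi> \<longleftrightarrow> (\<forall>n x. (dx ^^ n) \<phi> differentiable at x) \<and> (\<exists>R. \<forall>x. R < \<bar>x\<bar> \<longrightarrow> \<phi> x = 0)"

definition has_L2_weak_deriv :: "nat \<Rightarrow> (real \<Rightarrow> complex) \<Rightarrow> (real \<Rightarrow> complex) \<Rightarrow> bool" where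
  "has_L2_weak_deriv k f g \<longleftrightarrow> in_L2 g \<and>
    (\<forall>\<phi>. test_fun \<phi> \<longrightarrow>
      (LINT x|lebesgue. f x * (dx ^^ k) \<phi> x) = (-1) ^ k * (LINT x|lebesgue. g x * \<phi> x))"

text \<open>
  For $m \ge 0$, expanding $(1+\xi^2)^m$ and using Plancherel gives
  $\|\langle\xi\rangle^m \widehat f\|_{L^2}^2 = \sum_{k\le m} \binom{m}{k} \|\partial_x^k f\|_{L^2}^2$.
  The weak derivative is unique almost everywhere, so the choice does not affect the norm.
\<close>

definition in_Hpos :: "nat \<Rightarrow> (real \<Rightarrow> complex) \<Rightarrow> bool" where
  "in_Hpos m f \<longleftrightarrow> in_L2 f \<and> (\<forall>k\<le>m. \<exists>g. has_L2_weak_deriv k f g)"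

definition Hpos_norm :: "nat \<Rightarrow> (real \<Rightarrow> complex) \<Rightarrow> real" where
  "Hpos_norm m f =
    sqrt (\<Sum>k\<le>m. real (m choose k) * (L2_nrm (SOME g. has_L2_weak_deriv k f g))\<^sup>2)"

text \<open>$H^{-m}$ is the dual of $H^m$, here restricted to locally integrable functions.\<close>

definition in_Hneg :: "nat \<Rightarrow> (real \<Rightarrow> complex) \<Rightarrow> bool" where
  "in_Hneg m f \<longleftrightarrow> (\<forall>R. set_integrable lebesgue {-R..R} f) \<and>
    (\<exists>C. \<forall>\<phi>. test_fun \<phi> \<longrightarrow> norm (LINT x|lebesgue. f x * \<phi> x) \<le> C * Hpos_norm m \<phi>)"

definition Hneg_norm :: "nat \<Rightarrow> (real \<Rightarrow> complex) \<Rightarrow> real" where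
  "Hneg_norm m f = Inf {C. 0 \<le> C \<and>
    (\<forall>\<phi>. test_fun \<phi> \<longrightarrow> norm (LINT x|lebesgue. f x * \<phi> x) \<le> C * Hpos_norm m \<phi>)}"

definition in_H :: "int \<Rightarrow> (real \<Rightarrow> complex) \<Rightarrow> bool" where
  "in_H s f \<longleftrightarrow> (if 0 \<le> s then in_Hpos (nat s) f else in_Hneg (nat (- s)) f)"

definition H_norm :: "int \<Rightarrow> (real \<Rightarrow> complex) \<Rightarrow> real" where
  "H_norm s f = (if 0 \<le> s then Hpos_norm (nat s) f else Hneg_norm (nat (- s)) f)"

definition japanese :: "real \<Rightarrow> real" where
  "japanese x = sqrt (1 + x\<^sup>2)"

text \<open>
  Under the decay $|f| \lesssim \langle\xi\rangle^{-2}$ imposed below, \<open>in_Hw 0 1 f\<close> coincides with the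
  other common reading of $H^{0,1}$, namely $\langle\xi\rangle f \in L^2$: both hold automatically.
\<close>

definition in_Hw :: "int \<Rightarrow> nat \<Rightarrow> (real \<Rightarrow> complex) \<Rightarrow> bool" where
  "in_Hw s k f \<longleftrightarrow> (\<forall>\<sigma>\<le>k. in_H (s - int \<sigma>) (\<lambda>x. of_real (japanese x ^ \<sigma>) * f x))"

definition Hw_norm :: "int \<Rightarrow> nat \<Rightarrow> (real \<Rightarrow> complex) \<Rightarrow> real" where
  "Hw_norm s k f = (\<Sum>\<sigma>\<le>k. H_norm (s - int \<sigma>) (\<lambda>x. of_real (japanese x ^ \<sigma>) * f x))"

definition continuous_in_H31 :: "(real \<Rightarrow> real \<Rightarrow> complex) \<Rightarrow> bool" where
  "continuous_in_H31 u \<longleftrightarrow> (\<forall>t. in_Hw 3 1 (u t)) \<and>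
    (\<forall>t. ((\<lambda>s. Hw_norm 3 1 (\<lambda>x. u s x - u t x)) \<longlongrightarrow> 0) (at t))"


section \<open>Small-data solutions and their asymptotics\<close>

definition solves_profile_ODE ::
  "real^5 \<Rightarrow> real^3 \<Rightarrow> (real \<Rightarrow> complex) \<Rightarrow> (real \<Rightarrow> complex) \<Rightarrow> bool" where
  "solves_profile_ODE p q A1 A2 \<longleftrightarrow>
    (\<forall>\<tau>. A1 differentiable at \<tau> \<and> A2 differentiable at \<tau> \<and>
         \<i> * vector_derivative A1 (at \<tau>) = NLS_F1 p q (A1 \<tau>) (A2 \<tau>) \<and>
         \<i> * vector_derivative A2 (at \<tau>) = NLS_F2 p q (A1 \<tau>) (A2 \<tau>))"

definition has_asymptotics ::
  "real \<Rightarrow> real \<Rightarrow> (real \<Rightarrow> real \<Rightarrow> complex) \<Rightarrow> (real \<Rightarrow> real \<Rightarrow> complex) \<Rightarrow> bool" where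
  "has_asymptotics \<epsilon> \<delta> u A \<longleftrightarrow>
    (\<forall>\<beta>\<le>2. \<exists>C. \<forall>\<^sub>F t in at_top.
      Linf_norm UNIV (\<lambda>x. (dx ^^ \<beta>) (u t) x -
        (\<i> * of_real (x / (2 * t))) ^ \<beta> * (2 * \<i> * of_real t) powr (-1/2) *
        exp (\<i> * of_real (x\<^sup>2 / (4 * t))) * A (ln t / 2) (x / (2 * t)))
      \<le> ennreal (C * \<epsilon> * t powr (-3/4 + \<delta>)))"

definition associated_functions ::
  "real^5 \<Rightarrow> real^3 \<Rightarrow> real \<Rightarrow> real \<Rightarrow> (real \<Rightarrow> real \<Rightarrow> complex) \<Rightarrow> (real \<Rightarrow> real \<Rightarrow> complex) \<Rightarrow>
   (real \<Rightarrow> complex) \<Rightarrow> (real \<Rightarrow> complex) \<Rightarrow> bool" where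
  "associated_functions p q \<epsilon> \<delta> u1 u2 \<alpha>1 \<alpha>2 \<longleftrightarrow>
    in_Linf \<alpha>1 \<and> in_Linf \<alpha>2 \<and> in_Hw 0 1 \<alpha>1 \<and> in_Hw 0 1 \<alpha>2 \<and>
    (\<exists>C. AE \<xi> in lebesgue. norm (\<alpha>1 \<xi>) + norm (\<alpha>2 \<xi>) \<le> C * japanese \<xi> powr (-2)) \<and>
    (\<exists>A1 A2. (\<forall>\<xi>. solves_profile_ODE p q (\<lambda>\<tau>. A1 \<tau> \<xi>) (\<lambda>\<tau>. A2 \<tau> \<xi>) \<and>
                  A1 0 \<xi> = \<alpha>1 \<xi> \<and> A2 0 \<xi> = \<alpha>2 \<xi>) \<and>
             has_asymptotics \<epsilon> \<delta> u1 A1 \<and> has_asymptotics \<epsilon> \<delta> u2 A2)"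

text \<open>
  The thresholds $\delta_0$ and $\varepsilon_0 = \varepsilon_0(\delta)$ are arguments. The initial data are
  \<open>u1 0\<close> and \<open>u2 0\<close>.
\<close>

definition small_data_solution ::
  "real^5 \<Rightarrow> real^3 \<Rightarrow> real \<Rightarrow> (real \<Rightarrow> real) \<Rightarrow>
   (real \<Rightarrow> real \<Rightarrow> complex) \<Rightarrow> (real \<Rightarrow> real \<Rightarrow> complex) \<Rightarrow>
   (real \<Rightarrow> complex) \<Rightarrow> (real \<Rightarrow> complex) \<Rightarrow> bool" where
  "small_data_solution p q \<delta>0 \<epsilon>0 u1 u2 \<alpha>1 \<alpha>2 \<longleftrightarrow>
    continuous_in_H31 u1 \<and> continuous_in_H31 u2 \<and> solves_NLS p q u1 u2 \<and>
    (\<exists>\<delta>\<in>{0<..<\<delta>0}. let \<epsilon> = Hw_norm 3 1 (u1 0) + Hw_norm 3 1 (u2 0) in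
      \<epsilon> < \<epsilon>0 \<delta> \<and> associated_functions p q \<epsilon> \<delta> u1 u2 \<alpha>1 \<alpha>2)"


section \<open>The flow on the sphere and nonlinear synchronization\<close>

definition Q_field :: "real^5 \<Rightarrow> real \<Rightarrow> real^3 \<Rightarrow> real^3" where
  "Q_field p \<rho> v = (let D = v$1; R = v$2; I = v$3 in vector
    [2 * I * (p$1 * D + (p$2 - p$3) * R) + 2 * \<rho> * p$5 * I,
     2 * I * (- (p$2 + p$3) * D + p$1 * R) - 2 * \<rho> * p$4 * I,
     - 2 * p$1 * (D\<^sup>2 + R\<^sup>2) + 4 * p$3 * D * R + 2 * \<rho> * (- p$5 * D + p$4 * R)])"

definition Q_solution :: "real^5 \<Rightarrow> real \<Rightarrow> (real \<Rightarrow> real^3) \<Rightarrow> bool" where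
  "Q_solution p \<rho> X \<longleftrightarrow> (\<forall>\<tau>. (X has_vector_derivative Q_field p \<rho> (X \<tau>)) (at \<tau>))"

definition Q_fixed_points :: "real^5 \<Rightarrow> real \<Rightarrow> (real^3) set" where
  "Q_fixed_points p \<rho> = {v \<in> sphere 0 \<rho>. Q_field p \<rho> v = 0}"

definition omega_limit :: "(real \<Rightarrow> real^3) \<Rightarrow> (real^3) set" where
  "omega_limit X =
    {y. \<exists>s :: nat \<Rightarrow> real. filterlim s at_top sequentially \<and> (\<lambda>n. X (s n)) \<longlonglongrightarrow> y}"

definition strongly_attracting :: "real^5 \<Rightarrow> real \<Rightarrow> real^3 \<Rightarrow> bool" where
  "strongly_attracting p \<rho> pinf \<longleftrightarrow>
    (\<forall>X. Q_solution p \<rho> X \<and> X 0 \<in> sphere 0 \<rho> - Q_fixed_points p \<rho> \<longrightarrow> omega_limit X = {pinf})"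

definition Lyapunov_stable :: "real^5 \<Rightarrow> real \<Rightarrow> real^3 \<Rightarrow> bool" where
  "Lyapunov_stable p \<rho> pinf \<longleftrightarrow>
    (\<forall>U. openin (top_of_set (sphere 0 \<rho>)) U \<and> pinf \<in> U \<longrightarrow>
      (\<exists>V. openin (top_of_set (sphere 0 \<rho>)) V \<and> pinf \<in> V \<and>
        (\<forall>X. Q_solution p \<rho> X \<and> X 0 \<in> V \<longrightarrow> (\<forall>\<tau>\<ge>0. X \<tau> \<in> U))))"

text \<open>
  \<open>nonlinear_synchronization p \<rho> pinf\<close>: synchronization occurs for the flow on $S^2_\rho$, with
  asymptotically stable fixed point \<open>pinf\<close>.
\<close>

definition nonlinear_synchronization :: "real^5 \<Rightarrow> real \<Rightarrow> real^3 \<Rightarrow> bool" where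
  "nonlinear_synchronization p \<rho> pinf \<longleftrightarrow>
    finite (Q_fixed_points p \<rho>) \<and> pinf \<in> Q_fixed_points p \<rho> \<and>
    strongly_attracting p \<rho> pinf \<and> Lyapunov_stable p \<rho> pinf"


section \<open>The set of frequencies\<close>

definition Omega_set :: "(real \<Rightarrow> complex) \<Rightarrow> (real \<Rightarrow> complex) \<Rightarrow> (real^3) set \<Rightarrow> real set" where
  "Omega_set \<alpha>1 \<alpha>2 E =
    {\<xi>. vector [(cmod (\<alpha>1 \<xi>))\<^sup>2 - (cmod (\<alpha>2 \<xi>))\<^sup>2,
                2 * Re (cnj (\<alpha>1 \<xi>) * \<alpha>2 \<xi>),
                2 * Im (cnj (\<alpha>1 \<xi>) * \<alpha>2 \<xi>)] \<in> {k *\<^sub>R e | k e. e \<in> E \<and> 0 \<le> k}}"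

end

theory Submission
  imports Defs
begin

text \<open>
  The Hopf map $h(a,b) = (|a|^2-|b|^2,\, 2\,\mathrm{Re}\,\bar a b,\, 2\,\mathrm{Im}\,\bar a b)$ sends
  a profile $A = (A_1,A_2)$ to a trajectory of (Q) on the sphere of radius $\rho = |A_1|^2+|A_2|^2$,
  which is conserved; dividing by $\rho$ and slowing time down by the same factor gives a
  trajectory on $S^2$. If $h(a,b) = p_\infty$ with $|a|^2+|b|^2 = 1$, then
  $2|bA_1 - aA_2|^2 = \rho - p_\infty\cdot h(A)$ measures the distance to synchronization, which
  suggests $(\gamma_1,\gamma_2) = (b,-a)$. Compactness of $\mathfrak{E}$ and Lyapunov stability make
  the attraction to $p_\infty$ uniform in the initial point, and the asymptotics with $\beta = 0$
  transfer the decay of $\gamma_1A_1+\gamma_2A_2$ along rays $x = 2t\xi$ to the solution.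
\<close>

section \<open>Limits of trajectories and uniform attraction\<close>

text \<open>Membership in \<open>S\<close> is built in because a quadratic field is in general
  Lipschitz only on bounded sets. Trajectories run over all real times, so time may be shifted and
  reversed freely.\<close>

definition solution_in :: "('a::real_normed_vector \<Rightarrow> 'a) \<Rightarrow> 'a set \<Rightarrow> (real \<Rightarrow> 'a) \<Rightarrow> bool" where
  "solution_in f S X \<longleftrightarrow> (\<forall>t. X t \<in> S \<and> (X has_vector_derivative f (X t)) (at t))"

lemma solution_in_shift:
  assumes "solution_in f S X"
  shows "solution_in f S (\<lambda>t. X (s + t))"
  unfolding solution_in_def
proof (intro allI conjI)
  fix t
  show "X (s + t) \<in> S" using assms by (simp add: solution_in_def)
  have "(X has_vector_derivative f (X (s + t))) (at (s + t))"
    using assms by (simp add: solution_in_def)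
  moreover have "((\<lambda>t. s + t) has_vector_derivative 1) (at t)"
    by (auto intro!: derivative_eq_intros simp: has_real_derivative_iff_has_vector_derivative[symmetric])
  ultimately show "((\<lambda>t. X (s + t)) has_vector_derivative f (X (s + t))) (at t)"
    using vector_diff_chain_at[of "\<lambda>t. s + t" 1 t X "f (X (s + t))"] by (simp add: o_def)
qed

lemma solution_in_reflect:
  assumes "solution_in f S X"
  shows "solution_in (\<lambda>x. - f x) S (\<lambda>t. X (- t))"
  unfolding solution_in_def
proof (intro allI conjI)
  fix t
  show "X (- t) \<in> S" using assms by (simp add: solution_in_def)
  have "(X has_vector_derivative f (X (- t))) (at (- t))"
    using assms by (simp add: solution_in_def)
  moreover have "((\<lambda>t. - t) has_vector_derivative (- 1 :: real)) (at t)"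
    by (auto intro!: derivative_eq_intros simp: has_real_derivative_iff_has_vector_derivative[symmetric])
  ultimately show "((\<lambda>t. X (- t)) has_vector_derivative - f (X (- t))) (at t)"
    using vector_diff_chain_at[of "\<lambda>t. - t" "- 1" t X "f (X (- t))"] by (simp add: o_def)
qed

text \<open>Gronwall for the squared distance \<open>w\<close>, which is differentiable even where
  the trajectories meet: Cauchy-Schwarz and the Lipschitz bound give w' \<le> 2 L w, so
  \<open>w s * exp (- (2 * L * s))\<close> is nonincreasing.\<close>

lemma solution_dist_le_forward:
  fixes f :: "'a::real_inner \<Rightarrow> 'a"
  assumes L: "L-lipschitz_on S f" and X: "solution_in f S X" and Y: "solution_in f S Y" and "0 \<le> t"
  shows "dist (X t) (Y t) \<le> exp (L * t) * dist (X 0) (Y 0)"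
proof -
  define w where "w s = (X s - Y s) \<bullet> (X s - Y s)" for s
  have L0: "0 \<le> L" using L by (rule lipschitz_on_nonneg)
  have w': "(w has_real_derivative 2 * ((X s - Y s) \<bullet> (f (X s) - f (Y s)))) (at s)" for s
  proof -
    have "(X has_derivative (\<lambda>h. h *\<^sub>R f (X s))) (at s)" "(Y has_derivative (\<lambda>h. h *\<^sub>R f (Y s))) (at s)"
      using X Y by (simp_all add: solution_in_def has_vector_derivative_def)
    then show ?thesis
      unfolding w_def has_field_derivative_def
      by (auto intro!: derivative_eq_intros simp: inner_commute algebra_simps fun_eq_iff)
  qed
  have le: "(X s - Y s) \<bullet> (f (X s) - f (Y s)) \<le> L * w s" for s
  proof -
    have "(X s - Y s) \<bullet> (f (X s) - f (Y s)) \<le> norm (X s - Y s) * norm (f (X s) - f (Y s))"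
      by (rule norm_cauchy_schwarz)
    also have "\<dots> \<le> norm (X s - Y s) * (L * norm (X s - Y s))"
      using lipschitz_onD[OF L, of "X s" "Y s"] X Y
      by (intro mult_left_mono) (auto simp: solution_in_def dist_norm)
    also have "\<dots> = L * w s" by (simp add: w_def power2_norm_eq_inner[symmetric] power2_eq_square)
    finally show ?thesis .
  qed
  have "w t * exp (- (2 * L * t)) \<le> w 0 * exp (- (2 * L * 0))"
  proof (rule DERIV_nonpos_imp_nonincreasing[OF \<open>0 \<le> t\<close>])
    fix s
    have "((\<lambda>s. w s * exp (- (2 * L * s))) has_real_derivative
        2 * ((X s - Y s) \<bullet> (f (X s) - f (Y s)) - L * w s) * exp (- (2 * L * s))) (at s)"
      by (auto intro!: derivative_eq_intros w' simp: algebra_simps)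
    moreover have "2 * ((X s - Y s) \<bullet> (f (X s) - f (Y s)) - L * w s) * exp (- (2 * L * s)) \<le> 0"
      using le[of s] by (simp add: mult_le_0_iff)
    ultimately show "\<exists>y. ((\<lambda>s. w s * exp (- (2 * L * s))) has_real_derivative y) (at s) \<and> y \<le> 0"
      by blast
  qed
  then have "w t \<le> exp (2 * L * t) * w 0"
    by (simp add: exp_minus field_simps)
  also have "\<dots> = (exp (L * t) * dist (X 0) (Y 0))\<^sup>2"
    by (simp add: w_def power_mult_distrib dist_norm power2_norm_eq_inner exp_double[symmetric] mult.assoc)
  finally have "(dist (X t) (Y t))\<^sup>2 \<le> (exp (L * t) * dist (X 0) (Y 0))\<^sup>2"
    by (simp add: w_def dist_norm power2_norm_eq_inner)
  then show ?thesis by (rule power2_le_imp_le) simp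
qed

text \<open>Negative times reduce to positive ones by time reversal, which keeps the Lipschitz
  constant. Both directions are needed because limiting trajectories have to exist on the whole
  line.\<close>

lemma solution_dist_le:
  fixes f :: "'a::real_inner \<Rightarrow> 'a"
  assumes L: "L-lipschitz_on S f" and X: "solution_in f S X" and Y: "solution_in f S Y"
  shows "dist (X t) (Y t) \<le> exp (L * \<bar>t\<bar>) * dist (X 0) (Y 0)"
proof (cases "0 \<le> t")
  case True
  then show ?thesis using solution_dist_le_forward[OF L X Y] by simp
next
  case False
  have "L-lipschitz_on S (\<lambda>x. - f x)"
    using L by (simp add: lipschitz_on_def dist_minus)
  then show ?thesis
    using solution_dist_le_forward[OF _ solution_in_reflect[OF X] solution_in_reflect[OF Y], of L "- t"] False
    by simp
qed

text \<open>
  Gronwall makes the sequence locally uniformly Cauchy, so the limiting trajectory is obtained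
  without an existence theorem for the initial value problem.
\<close>

lemma solution_limit:
  fixes f :: "'a::euclidean_space \<Rightarrow> 'a"
  assumes L: "L-lipschitz_on S f" and "closed S"
    and X: "\<And>n. solution_in f S (X n)" and lim: "(\<lambda>n. X n 0) \<longlonglongrightarrow> x"
  obtains Y where "solution_in f S Y" "\<And>t. (\<lambda>n. X n t) \<longlonglongrightarrow> Y t"
proof -
  have conv: "convergent (\<lambda>n. X n t)" for t
  proof -
    have "Cauchy (\<lambda>n. X n t)"
    proof (rule metric_CauchyI)
      fix e :: real assume "0 < e"
      have "Cauchy (\<lambda>n. X n 0)" using lim by (rule LIMSEQ_imp_Cauchy)
      then obtain N where N: "\<And>m n. N \<le> m \<Longrightarrow> N \<le> n \<Longrightarrow> dist (X m 0) (X n 0) < e / exp (L * \<bar>t\<bar>)"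
        using \<open>0 < e\<close> by (metis metric_CauchyD divide_pos_pos exp_gt_zero)
      have "dist (X m t) (X n t) < e" if "N \<le> m" "N \<le> n" for m n
        using solution_dist_le[OF L X X, of m t n] N[OF that] by (simp add: field_simps)
      then show "\<exists>N. \<forall>m\<ge>N. \<forall>n\<ge>N. dist (X m t) (X n t) < e" by blast
    qed
    then show ?thesis by (simp add: Cauchy_convergent_iff)
  qed
  define Y where "Y t = lim (\<lambda>n. X n t)" for t
  have Y: "(\<lambda>n. X n t) \<longlonglongrightarrow> Y t" for t
    using conv[of t] by (simp add: Y_def convergent_LIMSEQ_iff)
  have YS: "Y t \<in> S" for t
    using closed_sequentially[OF \<open>closed S\<close> _ Y[of t]] X by (auto simp: solution_in_def)
  \<comment> \<open>\<open>Y\<close> is not yet known to be a trajectory, so the estimate is taken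
    between \<open>X n\<close> and \<open>X m\<close>, and \<open>m\<close> tends to
    infinity.\<close>
  have bnd: "dist (X n t) (Y t) \<le> exp (L * \<bar>t\<bar>) * dist (X n 0) (Y 0)" for n t
  proof (rule tendsto_le[OF sequentially_bot])
    show "(\<lambda>m. dist (X n t) (X m t)) \<longlonglongrightarrow> dist (X n t) (Y t)"
      by (intro tendsto_intros Y)
    show "(\<lambda>m. exp (L * \<bar>t\<bar>) * dist (X n 0) (X m 0)) \<longlonglongrightarrow> exp (L * \<bar>t\<bar>) * dist (X n 0) (Y 0)"
      by (intro tendsto_intros Y)
    show "\<forall>\<^sub>F m in sequentially. dist (X n t) (X m t) \<le> exp (L * \<bar>t\<bar>) * dist (X n 0) (X m 0)"
      using solution_dist_le[OF L X X] by simp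
  qed
  have L0: "0 \<le> L" using L by (rule lipschitz_on_nonneg)
  have "(Y has_vector_derivative f (Y t)) (at t)" for t
  proof -
    \<comment> \<open>The factor \<open>exp (L * \<bar>s\<bar>)\<close> is bounded only on bounded
      intervals. On this one, which contains \<open>t\<close>, the derivatives
      \<open>f (X n s)\<close> converge uniformly to \<open>f (Y s)\<close>, and limit and
      derivative may be exchanged.\<close>
    define T where "T = \<bar>t\<bar> + 1"
    have "0 < T" by (simp add: T_def add_nonneg_pos)
    have "\<exists>g. \<forall>s\<in>{- T<..<T}. (\<lambda>n. X n s) \<longlonglongrightarrow> g s \<and>
        (g has_derivative (\<lambda>h. h *\<^sub>R f (Y s))) (at s within {- T<..<T})"
    proof (rule has_derivative_sequence)
      show "(X n has_derivative (\<lambda>h. h *\<^sub>R f (X n s))) (at s within {- T<..<T})" for n s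
        using X[of n] by (auto simp: solution_in_def has_vector_derivative_def intro: has_derivative_at_withinI)
      show "(\<lambda>n. X n 0) \<longlonglongrightarrow> x" by (rule lim)
      show "0 \<in> {- T<..<T}" using \<open>0 < T\<close> by simp
      fix e :: real assume "0 < e"
      define c where "c = L * exp (L * T)"
      have "(\<lambda>n. c * dist (X n 0) (Y 0)) \<longlonglongrightarrow> c * dist (Y 0) (Y 0)"
        by (intro tendsto_intros Y)
      then have "\<forall>\<^sub>F n in sequentially. c * dist (X n 0) (Y 0) < e"
        using \<open>0 < e\<close> by (intro order_tendstoD(2)) auto
      then show "\<forall>\<^sub>F n in sequentially. \<forall>s\<in>{- T<..<T}. \<forall>h.
          norm (h *\<^sub>R f (X n s) - h *\<^sub>R f (Y s)) \<le> e * norm h"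
      proof eventually_elim
        case (elim n)
        show ?case
        proof (intro ballI allI)
          fix s h :: real assume s: "s \<in> {- T<..<T}"
          have "dist (f (X n s)) (f (Y s)) \<le> L * dist (X n s) (Y s)"
            using lipschitz_onD[OF L] X YS by (auto simp: solution_in_def)
          also have "\<dots> \<le> L * (exp (L * \<bar>s\<bar>) * dist (X n 0) (Y 0))"
            using bnd L0 by (intro mult_left_mono) auto
          also have "\<dots> \<le> L * (exp (L * T) * dist (X n 0) (Y 0))"
            using s L0 by (intro mult_left_mono mult_right_mono) (auto intro: mult_left_mono)
          also have "\<dots> \<le> e" using elim by (simp add: c_def mult.assoc)
          finally have "norm (f (X n s) - f (Y s)) \<le> e" by (simp add: dist_norm)
          then have "\<bar>h\<bar> * norm (f (X n s) - f (Y s)) \<le> \<bar>h\<bar> * e"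
            by (intro mult_left_mono) auto
          then show "norm (h *\<^sub>R f (X n s) - h *\<^sub>R f (Y s)) \<le> e * norm h"
            by (simp add: scaleR_diff_right[symmetric] mult.commute)
        qed
      qed
    qed auto
    then obtain g where g: "\<And>s. s \<in> {- T<..<T} \<Longrightarrow> (\<lambda>n. X n s) \<longlonglongrightarrow> g s"
      "\<And>s. s \<in> {- T<..<T} \<Longrightarrow> (g has_derivative (\<lambda>h. h *\<^sub>R f (Y s))) (at s within {- T<..<T})"
      by blast
    have gY: "g s = Y s" if "s \<in> {- T<..<T}" for s
      using LIMSEQ_unique[OF g(1)[OF that] Y] .
    have t: "t \<in> {- T<..<T}" by (auto simp: T_def)
    have "(g has_vector_derivative f (Y t)) (at t)"
      using g(2)[OF t] at_within_open[OF t open_greaterThanLessThan]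
      by (simp only: has_vector_derivative_def)
    then show ?thesis
      by (rule has_vector_derivative_transform_within_open[OF _ open_greaterThanLessThan t]) (rule gY)
  qed
  then have "solution_in f S Y" using YS by (simp add: solution_in_def)
  then show ?thesis using Y that by blast
qed

text \<open>
  Otherwise trajectories starting in \<open>K\<close> and outside \<open>U\<close> at times tending to infinity have a
  limiting trajectory; it enters the neighbourhood given by Lyapunov stability, hence so do the
  trajectories themselves from some index on, and these can then no longer leave \<open>U\<close>.
\<close>

lemma uniform_attraction:
  fixes f :: "'a::euclidean_space \<Rightarrow> 'a"
  assumes L: "L-lipschitz_on S f" and S: "closed S" and K: "compact K"
    and stable: "\<And>U. openin (top_of_set S) U \<Longrightarrow> z \<in> U \<Longrightarrow>
      \<exists>V. openin (top_of_set S) V \<and> z \<in> V \<and> (\<forall>X. solution_in f S X \<and> X 0 \<in> V \<longrightarrow> (\<forall>t\<ge>0. X t \<in> U))"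
    and attract: "\<And>X. solution_in f S X \<Longrightarrow> X 0 \<in> K \<Longrightarrow> X 0 \<noteq> z \<Longrightarrow>
      \<exists>s. filterlim s at_top sequentially \<and> (\<lambda>n::nat. X (s n)) \<longlonglongrightarrow> z"
    and U: "openin (top_of_set S) U" "z \<in> U"
  shows "\<exists>T. \<forall>X t. solution_in f S X \<longrightarrow> X 0 \<in> K \<longrightarrow> T \<le> t \<longrightarrow> X t \<in> U"
proof (rule ccontr)
  assume "\<not> ?thesis"
  then have "\<forall>n::nat. \<exists>X t. solution_in f S X \<and> X 0 \<in> K \<and> real n \<le> t \<and> X t \<notin> U"
    by metis
  then obtain X t where X: "\<And>n::nat. solution_in f S (X n)" "\<And>n. X n 0 \<in> K" "\<And>n. real n \<le> t n"
      "\<And>n. X n (t n) \<notin> U"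
    by metis
  obtain V where V: "openin (top_of_set S) V" "z \<in> V"
      and stay: "\<And>X t. solution_in f S X \<Longrightarrow> X 0 \<in> V \<Longrightarrow> 0 \<le> t \<Longrightarrow> X t \<in> U"
    using stable[OF U] by blast
  obtain W where W: "open W" "V = S \<inter> W" using V(1) by (auto simp: openin_open)
  obtain x r where x: "x \<in> K" "strict_mono r" "((\<lambda>n. X n 0) \<circ> r) \<longlonglongrightarrow> x"
    using K X(2) by (metis compact_def)
  obtain Y where Y: "solution_in f S Y" "\<And>t. (\<lambda>n. X (r n) t) \<longlonglongrightarrow> Y t"
    using solution_limit[OF L S, of "\<lambda>n. X (r n)" x] X(1) x(3) by (auto simp: o_def)
  have "Y 0 = x" using LIMSEQ_unique[OF Y(2)[of 0]] x(3) by (simp add: o_def)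
  \<comment> \<open>If the limiting trajectory starts at \<open>z\<close> itself, time 0 serves;
    otherwise the attraction hypothesis supplies the time.\<close>
  have "\<exists>s. Y s \<in> V"
  proof (cases "x = z")
    case True
    then show ?thesis using \<open>Y 0 = x\<close> V by metis
  next
    case False
    then obtain s where "filterlim s at_top sequentially" "(\<lambda>n::nat. Y (s n)) \<longlonglongrightarrow> z"
      using attract[OF Y(1)] \<open>Y 0 = x\<close> x(1) by auto
    then have "\<forall>\<^sub>F n in sequentially. Y (s n) \<in> W"
      using W V(2) by (intro topological_tendstoD) auto
    then obtain n where "Y (s n) \<in> W" by (auto simp: eventually_sequentially)
    then show ?thesis using W Y(1) by (auto simp: solution_in_def)
  qed
  then obtain s where "Y s \<in> W" using W by auto
  then have "\<forall>\<^sub>F n in sequentially. X (r n) s \<in> W"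
    using topological_tendstoD[OF Y(2) W(1)] by blast
  moreover have "\<forall>\<^sub>F n in sequentially. s \<le> real n"
    using filterlim_real_sequentially by (simp add: filterlim_at_top)
  ultimately have "\<forall>\<^sub>F n in sequentially. X (r n) s \<in> W \<and> s \<le> real n"
    by eventually_elim auto
  then obtain n where n: "X (r n) s \<in> W" "s \<le> real n" by (auto simp: eventually_sequentially)
  \<comment> \<open>The exit time comes after the entrance into \<open>V\<close>, since
    \<open>s\<close> \<le> \<open>n\<close> \<le> \<open>r n\<close> \<le> \<open>t (r n)\<close>.
    Shifting time by \<open>s\<close> then contradicts stability.\<close>
  have "s \<le> t (r n)"
    using n(2) X(3)[of "r n"] seq_suble[OF x(2), of n] by linarith
  moreover have "X (r n) s \<in> V" using n(1) X(1) W by (auto simp: solution_in_def)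
  ultimately have "X (r n) (s + (t (r n) - s)) \<in> U"
    by (intro stay[OF solution_in_shift[OF X(1)[of "r n"], of s]]) auto
  then have "X (r n) (t (r n)) \<in> U" by (simp only: add_diff_cancel_left' diff_add_cancel add.commute[of s])
  then show False using X(4) by blast
qed

section \<open>The Hopf map and the profile equation\<close>

lemma vector_3_eq_sum_axis:
  "(vector [x, y, z] :: real^3) = x *\<^sub>R axis 1 1 + y *\<^sub>R axis 2 1 + z *\<^sub>R axis 3 1"
  by (simp add: vec_eq_iff forall_3 axis_def)

lemma vector_3_has_vector_derivative:
  fixes f g h :: "real \<Rightarrow> real"
  assumes "(f has_real_derivative f') (at t)" "(g has_real_derivative g') (at t)"
    "(h has_real_derivative h') (at t)"
  shows "((\<lambda>t. vector [f t, g t, h t] :: real^3) has_vector_derivative vector [f', g', h']) (at t)"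
proof -
  show ?thesis
    unfolding vector_3_eq_sum_axis
    using assms by (auto intro!: derivative_eq_intros)
qed

text \<open>The components are polynomials of degree at most two, and coordinates on the unit sphere
  are at most 1 in modulus; hence a product of two coordinates changes by at most twice the distance
  of the points.\<close>

lemma Q_field_lipschitz: "\<exists>L. L-lipschitz_on (sphere 0 1) (Q_field p \<rho>)"
proof -
  define c where "c = \<bar>p$1\<bar> + \<bar>p$2\<bar> + \<bar>p$3\<bar> + \<bar>\<rho> * p$4\<bar> + \<bar>\<rho> * p$5\<bar>"
  have prod: "\<bar>a * b - a' * b'\<bar> \<le> 2 * d"
    if "\<bar>a - a'\<bar> \<le> d" "\<bar>b - b'\<bar> \<le> d" "\<bar>a\<bar> \<le> 1" "\<bar>b'\<bar> \<le> 1" for a b a' b' d :: real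
  proof -
    have "a * b - a' * b' = a * (b - b') + (a - a') * b'" by (simp add: algebra_simps)
    then have "\<bar>a * b - a' * b'\<bar> \<le> \<bar>a\<bar> * \<bar>b - b'\<bar> + \<bar>a - a'\<bar> * \<bar>b'\<bar>"
      by (metis abs_mult abs_triangle_ineq)
    also have "\<dots> \<le> 1 * d + d * 1"
      using that by (intro add_mono mult_mono) auto
    finally show ?thesis by simp
  qed
  have scale: "\<bar>k * x\<bar> \<le> \<bar>k\<bar> * m" if "\<bar>x\<bar> \<le> m" for k x m :: real
    using that by (simp add: abs_mult mult_left_mono)
  \<comment> \<open>In units of \<open>e = c * (2 * d)\<close> the three components contribute 8, 8
    and 12, the sums of their numerical coefficients. This gives 28 \<open>e\<close>, that is 56
    \<open>c * d\<close>.\<close>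
  have "dist (Q_field p \<rho> v) (Q_field p \<rho> w) \<le> 56 * c * dist v w"
    if "v \<in> sphere 0 1" "w \<in> sphere 0 1" for v w
  proof -
    define d where "d = dist v w"
    have le1: "\<bar>v$i\<bar> \<le> 1" "\<bar>w$i\<bar> \<le> 1" for i
      using that component_le_norm_cart[of v i] component_le_norm_cart[of w i] by auto
    have led: "\<bar>v$i - w$i\<bar> \<le> d" for i
      using component_le_norm_cart[of "v - w" i] by (simp add: d_def dist_norm)
    have d0: "0 \<le> d" by (simp add: d_def)
    define e where "e = c * (2 * d)"
    have quad: "\<bar>k * (v$i * v$j - w$i * w$j)\<bar> \<le> e" if "\<bar>k\<bar> \<le> c" for k i j
    proof -
      have "\<bar>k * (v$i * v$j - w$i * w$j)\<bar> \<le> \<bar>k\<bar> * (2 * d)" by (intro scale prod led le1)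
      also have "\<dots> \<le> e" unfolding e_def using that d0 by (intro mult_right_mono) auto
      finally show ?thesis .
    qed
    have lin: "\<bar>k * (v$i - w$i)\<bar> \<le> e" if "\<bar>k\<bar> \<le> c" for k i
    proof -
      have "\<bar>k * (v$i - w$i)\<bar> \<le> \<bar>k\<bar> * (2 * d)" using led[of i] d0 by (intro scale) linarith
      also have "\<dots> \<le> e" unfolding e_def using that d0 by (intro mult_right_mono) auto
      finally show ?thesis .
    qed
    have pc: "\<bar>p$1\<bar> \<le> c" "\<bar>p$2\<bar> \<le> c" "\<bar>p$3\<bar> \<le> c" "\<bar>\<rho> * p$4\<bar> \<le> c" "\<bar>\<rho> * p$5\<bar> \<le> c"
      by (simp_all add: c_def)
    have "(Q_field p \<rho> v - Q_field p \<rho> w) $ 1 =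
        2 * (p$1 * (v$3 * v$1 - w$3 * w$1)) + 2 * (p$2 * (v$3 * v$2 - w$3 * w$2))
        - 2 * (p$3 * (v$3 * v$2 - w$3 * w$2)) + 2 * ((\<rho> * p$5) * (v$3 - w$3))"
      by (simp add: Q_field_def Let_def algebra_simps)
    then have comp1: "\<bar>(Q_field p \<rho> v - Q_field p \<rho> w) $ 1\<bar> \<le> 8 * e"
      using quad[OF pc(1), of 3 1] quad[OF pc(2), of 3 2] quad[OF pc(3), of 3 2] lin[OF pc(5), of 3]
      by linarith
    have "(Q_field p \<rho> v - Q_field p \<rho> w) $ 2 =
        2 * (p$1 * (v$3 * v$2 - w$3 * w$2)) - 2 * (p$2 * (v$3 * v$1 - w$3 * w$1))
        - 2 * (p$3 * (v$3 * v$1 - w$3 * w$1)) - 2 * ((\<rho> * p$4) * (v$3 - w$3))"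
      by (simp add: Q_field_def Let_def algebra_simps)
    then have comp2: "\<bar>(Q_field p \<rho> v - Q_field p \<rho> w) $ 2\<bar> \<le> 8 * e"
      using quad[OF pc(1), of 3 2] quad[OF pc(2), of 3 1] quad[OF pc(3), of 3 1] lin[OF pc(4), of 3]
      by linarith
    have "(Q_field p \<rho> v - Q_field p \<rho> w) $ 3 =
        - 2 * (p$1 * (v$1 * v$1 - w$1 * w$1)) - 2 * (p$1 * (v$2 * v$2 - w$2 * w$2))
        + 4 * (p$3 * (v$1 * v$2 - w$1 * w$2))
        - 2 * ((\<rho> * p$5) * (v$1 - w$1)) + 2 * ((\<rho> * p$4) * (v$2 - w$2))"
      by (simp add: Q_field_def Let_def algebra_simps power2_eq_square)
    then have comp3: "\<bar>(Q_field p \<rho> v - Q_field p \<rho> w) $ 3\<bar> \<le> 12 * e"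
      using quad[OF pc(1), of 1 1] quad[OF pc(1), of 2 2] quad[OF pc(3), of 1 2]
        lin[OF pc(5), of 1] lin[OF pc(4), of 2]
      by linarith
    have "norm (Q_field p \<rho> v - Q_field p \<rho> w) \<le> (\<Sum>i\<in>UNIV. \<bar>(Q_field p \<rho> v - Q_field p \<rho> w) $ i\<bar>)"
      by (rule norm_le_l1_cart)
    also have "\<dots> \<le> 28 * e"
      using comp1 comp2 comp3 unfolding sum_3 by linarith
    finally show ?thesis by (simp add: dist_norm d_def e_def)
  qed
  then have "(56 * c)-lipschitz_on (sphere 0 1) (Q_field p \<rho>)"
    by (intro lipschitz_onI) (auto simp: c_def)
  then show ?thesis by blast
qed

text \<open>Every monomial has degree two in the radius and the point jointly. This is what reduces
  all spheres to the unit sphere.\<close>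

lemma Q_field_scaleR: "Q_field p (k * \<rho>) (k *\<^sub>R v) = k\<^sup>2 *\<^sub>R Q_field p \<rho> v"
  by (simp add: Q_field_def Let_def vec_eq_iff forall_3 algebra_simps power2_eq_square)

section \<open>Algebra of the Hopf map\<close>

definition hopf :: "complex \<Rightarrow> complex \<Rightarrow> real^3" where
  "hopf a b = vector [(cmod a)\<^sup>2 - (cmod b)\<^sup>2, 2 * Re (cnj a * b), 2 * Im (cnj a * b)]"

lemma norm_hopf: "norm (hopf a b) = (cmod a)\<^sup>2 + (cmod b)\<^sup>2"
proof -
  have "hopf a b \<bullet> hopf a b = ((cmod a)\<^sup>2 + (cmod b)\<^sup>2)\<^sup>2"
    unfolding hopf_def inner_vec_def sum_3
    by (simp add: cmod_power2) (simp add: power2_eq_square algebra_simps)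
  then have "(norm (hopf a b))\<^sup>2 = ((cmod a)\<^sup>2 + (cmod b)\<^sup>2)\<^sup>2"
    by (simp add: power2_norm_eq_inner)
  then show ?thesis by (simp add: power2_eq_iff_nonneg)
qed

text \<open>Lagrange's identity splits the product of the masses into the squared moduli of
  \<open>cnj a * c + cnj b * d\<close> and of the determinant \<open>b * c - a * d\<close>; the
  inner product of the Hopf images is the first minus the second. The determinant vanishes exactly
  for linearly dependent pairs.\<close>

lemma cmod_cross_sq:
  "2 * (cmod (b * c - a * d))\<^sup>2 = ((cmod a)\<^sup>2 + (cmod b)\<^sup>2) * ((cmod c)\<^sup>2 + (cmod d)\<^sup>2) - hopf a b \<bullet> hopf c d"
  unfolding hopf_def inner_vec_def sum_3
  by (simp add: cmod_power2) (simp add: power2_eq_square algebra_simps)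

text \<open>A common phase of \<open>a\<close> and \<open>b\<close> does not change the image, so
  \<open>a\<close> may be taken real and nonnegative. Mass 1 and the first coordinate force a^2 = (1
  + z1) / 2, and the other two coordinates give \<open>b\<close> after division by 2
  \<open>a\<close>. Only the pole with \<open>a\<close> = 0 needs its own preimage.\<close>

lemma hopf_surj_on_sphere:
  assumes "z \<in> sphere 0 1"
  obtains a b where "hopf a b = z"
proof -
  have z: "(z$1)\<^sup>2 + (z$2)\<^sup>2 + (z$3)\<^sup>2 = 1"
    using assms by (simp add: norm_vec_def L2_set_def sum_3 real_sqrt_eq_1_iff)
  show ?thesis
  proof (cases "z$1 = -1")
    case True
    then have "(z$2)\<^sup>2 + (z$3)\<^sup>2 = 0" using z by simp
    then have "z$2 = 0" "z$3 = 0" by (simp_all add: sum_power2_eq_zero_iff)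
    then have "hopf 0 1 = z" using True by (simp add: hopf_def vec_eq_iff forall_3)
    then show ?thesis by (rule that)
  next
    case False
    have "(z$1)\<^sup>2 \<le> 1" using z by (smt (verit) zero_le_power2)
    then have "\<bar>z$1\<bar> \<le> 1" by (simp add: abs_square_le_1)
    then have pos: "0 < 1 + z$1" using False by linarith
    define r where "r = sqrt ((1 + z$1) / 2)"
    have r: "0 < r" "r\<^sup>2 = (1 + z$1) / 2" using pos by (simp_all add: r_def)
    define b where "b = Complex (z$2 / (2 * r)) (z$3 / (2 * r))"
    have yz: "(z$2)\<^sup>2 + (z$3)\<^sup>2 = (1 - z$1) * (1 + z$1)"
      using z by (simp add: power2_eq_square algebra_simps)
    have "(cmod b)\<^sup>2 = ((z$2)\<^sup>2 + (z$3)\<^sup>2) / (4 * r\<^sup>2)"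
      by (simp add: b_def cmod_power2 power_divide power_mult_distrib add_divide_distrib)
    also have "\<dots> = (1 - z$1) * (1 + z$1) / (4 * ((1 + z$1) / 2))"
      unfolding yz r(2) ..
    also have "\<dots> = (1 - z$1) / 2" using pos by (simp add: divide_simps)
    finally have b: "(cmod b)\<^sup>2 = (1 - z$1) / 2" .
    have "hopf (of_real r) b = z"
      using r b by (simp add: hopf_def vec_eq_iff forall_3 field_simps) (simp add: b_def field_simps)
    then show ?thesis by (rule that)
  qed
qed

section \<open>The profile equation in Hopf coordinates\<close>

context
  fixes p :: "real^5" and q :: "real^3" and A1 A2 :: "real \<Rightarrow> complex"
  assumes A: "solves_profile_ODE p q A1 A2"
begin

text \<open>In real coordinates the conservation law and the equation for the Hopf image become
  polynomial identities that can be checked by expansion.\<close>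

lemma profile_Re_Im_derivatives:
  "((\<lambda>t. Re (A1 t)) has_real_derivative Im (NLS_F1 p q (A1 t) (A2 t))) (at t)"
  "((\<lambda>t. Im (A1 t)) has_real_derivative - Re (NLS_F1 p q (A1 t) (A2 t))) (at t)"
  "((\<lambda>t. Re (A2 t)) has_real_derivative Im (NLS_F2 p q (A1 t) (A2 t))) (at t)"
  "((\<lambda>t. Im (A2 t)) has_real_derivative - Re (NLS_F2 p q (A1 t) (A2 t))) (at t)"
proof -
  have *: "((\<lambda>t. Re (B t)) has_real_derivative Im F) (at t)"
      "((\<lambda>t. Im (B t)) has_real_derivative - Re F) (at t)"
    if "B differentiable at t" "\<i> * vector_derivative B (at t) = F" for B F
  proof -
    have B: "(B has_vector_derivative vector_derivative B (at t)) (at t)"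
      using that(1) by (simp add: vector_derivative_works)
    have "Re (vector_derivative B (at t)) = Im F" "Im (vector_derivative B (at t)) = - Re F"
      unfolding that(2)[symmetric] by simp_all
    then show "((\<lambda>t. Re (B t)) has_real_derivative Im F) (at t)"
        "((\<lambda>t. Im (B t)) has_real_derivative - Re F) (at t)"
      using bounded_linear.has_vector_derivative[OF bounded_linear_Re B]
        bounded_linear.has_vector_derivative[OF bounded_linear_Im B]
      by (simp_all add: has_real_derivative_iff_has_vector_derivative)
  qed
  show "((\<lambda>t. Re (A1 t)) has_real_derivative Im (NLS_F1 p q (A1 t) (A2 t))) (at t)"
    "((\<lambda>t. Im (A1 t)) has_real_derivative - Re (NLS_F1 p q (A1 t) (A2 t))) (at t)"
    "((\<lambda>t. Re (A2 t)) has_real_derivative Im (NLS_F2 p q (A1 t) (A2 t))) (at t)"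
    "((\<lambda>t. Im (A2 t)) has_real_derivative - Re (NLS_F2 p q (A1 t) (A2 t))) (at t)"
    using A unfolding solves_profile_ODE_def by (blast intro: *)+
qed

text \<open>The derivative is twice the imaginary part of \<open>cnj A1 * F1 + cnj A2 * F2\<close>,
  which vanishes identically.\<close>

lemma profile_mass_const: "(cmod (A1 t))\<^sup>2 + (cmod (A2 t))\<^sup>2 = (cmod (A1 0))\<^sup>2 + (cmod (A2 0))\<^sup>2"
proof (rule DERIV_isconst_all[where f = "\<lambda>t. (cmod (A1 t))\<^sup>2 + (cmod (A2 t))\<^sup>2"], intro allI)
  fix t
  show "((\<lambda>t. (cmod (A1 t))\<^sup>2 + (cmod (A2 t))\<^sup>2) has_real_derivative 0) (at t)"
    unfolding cmod_power2
    apply (rule profile_Re_Im_derivatives derivative_eq_intros refl)+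
    apply (simp only: NLS_F1_def NLS_F2_def cmod_power2)
    apply (simp add: power2_eq_square)
    apply (simp add: algebra_simps)
    done
qed

text \<open>The real potential \<open>NLS_V\<close> only rotates a common phase of both components,
  which the Hopf map does not see; the parameters \<open>q\<close> therefore drop out.\<close>

lemma hopf_profile_has_vector_derivative:
  "((\<lambda>t. hopf (A1 t) (A2 t)) has_vector_derivative
    Q_field p ((cmod (A1 t))\<^sup>2 + (cmod (A2 t))\<^sup>2) (hopf (A1 t) (A2 t))) (at t)"
  unfolding hopf_def Q_field_def Let_def vector_3
  apply (rule vector_3_has_vector_derivative)
  subgoal
    unfolding cmod_power2
    apply (rule profile_Re_Im_derivatives derivative_eq_intros refl)+
    apply (simp only: NLS_F1_def NLS_F2_def cmod_power2)
    apply (simp add: power2_eq_square)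
    apply (simp add: algebra_simps)
    done
  subgoal
    unfolding cmod_power2 times_complex.sel cnj.sel
    apply (rule profile_Re_Im_derivatives derivative_eq_intros refl)+
    apply (simp only: NLS_F1_def NLS_F2_def NLS_V_def cmod_power2)
    apply (simp add: power2_eq_square)
    apply (simp add: algebra_simps)
    done
  subgoal
    unfolding cmod_power2 times_complex.sel cnj.sel
    apply (rule profile_Re_Im_derivatives derivative_eq_intros refl)+
    apply (simp only: NLS_F1_def NLS_F2_def NLS_V_def cmod_power2)
    apply (simp add: power2_eq_square)
    apply (simp add: algebra_simps)
    done
  done

lemma normalized_profile_solution:
  assumes \<rho>: "\<rho> = (cmod (A1 0))\<^sup>2 + (cmod (A2 0))\<^sup>2" "0 < \<rho>"
  shows "solution_in (Q_field p 1) (sphere 0 1) (\<lambda>s. (1 / \<rho>) *\<^sub>R hopf (A1 (s / \<rho>)) (A2 (s / \<rho>)))"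
  unfolding solution_in_def
proof (intro allI conjI)
  fix s
  let ?H = "\<lambda>t. hopf (A1 t) (A2 t)"
  have "norm (?H (s / \<rho>)) = \<rho>"
    using profile_mass_const[of "s / \<rho>"] unfolding norm_hopf \<rho>(1)[symmetric] .
  then show "(1 / \<rho>) *\<^sub>R ?H (s / \<rho>) \<in> sphere 0 1"
    using \<rho>(2) by simp
  have "(?H has_vector_derivative Q_field p \<rho> (?H (s / \<rho>))) (at (s / \<rho>))"
    using hopf_profile_has_vector_derivative[of "s / \<rho>"] profile_mass_const[of "s / \<rho>"] \<rho>(1)[symmetric] by simp
  moreover have "((\<lambda>s. s / \<rho>) has_vector_derivative 1 / \<rho>) (at s)"
    using \<rho>(2) by (auto intro!: derivative_eq_intros simp: has_real_derivative_iff_has_vector_derivative[symmetric])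
  ultimately have "((\<lambda>s. ?H (s / \<rho>)) has_vector_derivative (1 / \<rho>) *\<^sub>R Q_field p \<rho> (?H (s / \<rho>))) (at s)"
    using vector_diff_chain_at[of "\<lambda>s. s / \<rho>" "1 / \<rho>" s ?H] by (simp add: o_def)
  then have "((\<lambda>s. (1 / \<rho>) *\<^sub>R ?H (s / \<rho>)) has_vector_derivative
      (1 / \<rho>) *\<^sub>R (1 / \<rho>) *\<^sub>R Q_field p \<rho> (?H (s / \<rho>))) (at s)"
    by (rule bounded_linear.has_vector_derivative[OF bounded_linear_scaleR_right])
  \<comment> \<open>One factor comes from the normalization and one from the slowed clock;
    homogeneity of degree two absorbs both.\<close>
  moreover have "(1 / \<rho>) *\<^sub>R (1 / \<rho>) *\<^sub>R Q_field p \<rho> (?H (s / \<rho>)) = Q_field p 1 ((1 / \<rho>) *\<^sub>R ?H (s / \<rho>))"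
    using Q_field_scaleR[of p "1 / \<rho>" \<rho> "?H (s / \<rho>)"] \<rho>(2) by (simp add: power2_eq_square)
  ultimately show "((\<lambda>s. (1 / \<rho>) *\<^sub>R ?H (s / \<rho>)) has_vector_derivative
      Q_field p 1 ((1 / \<rho>) *\<^sub>R ?H (s / \<rho>))) (at s)"
    by simp
qed

end

section \<open>Synchronization of the profiles\<close>

text \<open>The set \<open>E\<close> is compact as a closed part of the sphere, and \<open>z\<close>
  is the only fixed point it may contain. All its other points are attracted to \<open>z\<close> by
  synchronization, so the general uniformity result applies.\<close>

lemma synchronization_uniform_attraction:
  assumes sync: "nonlinear_synchronization p 1 z"
    and E: "closed E" "E \<subseteq> sphere 0 1 - (Q_fixed_points p 1 - {z})"
    and U: "openin (top_of_set (sphere 0 1)) U" "z \<in> U"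
  shows "\<exists>T. \<forall>X t. solution_in (Q_field p 1) (sphere 0 1) X \<longrightarrow> X 0 \<in> E \<longrightarrow> T \<le> t \<longrightarrow> X t \<in> U"
proof -
  obtain L where L: "L-lipschitz_on (sphere 0 1) (Q_field p 1)"
    using Q_field_lipschitz by blast
  have Q: "Q_solution p 1 X" if "solution_in (Q_field p 1) (sphere 0 1) X" for X
    using that by (simp add: solution_in_def Q_solution_def)
  have "E \<inter> sphere 0 1 = E" using E(2) by auto
  then have "compact E"
    using closed_Int_compact[OF E(1) compact_sphere, of 0 1] by simp
  then show ?thesis
  proof (rule uniform_attraction[OF L closed_sphere _ _ _ U])
    fix U assume "openin (top_of_set (sphere 0 1)) U" "z \<in> U"
    then show "\<exists>V. openin (top_of_set (sphere 0 1)) V \<and> z \<in> V \<and>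
        (\<forall>X. solution_in (Q_field p 1) (sphere 0 1) X \<and> X 0 \<in> V \<longrightarrow> (\<forall>t\<ge>0. X t \<in> U))"
      using sync Q unfolding nonlinear_synchronization_def Lyapunov_stable_def by meson
  next
    fix X assume X: "solution_in (Q_field p 1) (sphere 0 1) X" "X 0 \<in> E" "X 0 \<noteq> z"
    have "X 0 \<in> sphere 0 1 - Q_fixed_points p 1" using X(2,3) E(2) by blast
    then have "omega_limit X = {z}"
      using sync Q[OF X(1)] unfolding nonlinear_synchronization_def strongly_attracting_def by blast
    then have "z \<in> omega_limit X" by simp
    then show "\<exists>s. filterlim s at_top sequentially \<and> (\<lambda>n::nat. X (s n)) \<longlonglongrightarrow> z"
      unfolding omega_limit_def by simp
  qed
qed

text \<open>The time \<open>T\<close> is the same for all profiles that start in the cone over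
  \<open>E\<close> with mass at most \<open>M\<close>; this uniformity is what turns decay for each
  frequency into decay of a supremum.\<close>

lemma profile_combination_uniformly_small:
  assumes sync: "nonlinear_synchronization p 1 z"
    and E: "closed E" "E \<subseteq> sphere 0 1 - (Q_fixed_points p 1 - {z})"
    and z: "z = hopf a b" "norm z = 1"
    and \<eta>: "0 < \<eta>"
  shows "\<exists>T. \<forall>A1 A2 \<tau>. solves_profile_ODE p q A1 A2 \<longrightarrow>
    hopf (A1 0) (A2 0) \<in> {k *\<^sub>R e | k e. e \<in> E \<and> 0 \<le> k} \<longrightarrow>
    (cmod (A1 0))\<^sup>2 + (cmod (A2 0))\<^sup>2 \<le> M \<longrightarrow> T \<le> \<tau> \<longrightarrow>
    cmod (b * A1 \<tau> - a * A2 \<tau>) \<le> \<eta>"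
proof -
  \<comment> \<open>For a normalized point \<open>v\<close> and mass \<rho> the identity for the
    combination reads 2 |b A1 - a A2|^2 = \<rho> (1 - z . v), so \<open>U\<close> guarantees the
    bound for every mass up to \<open>M\<close>.\<close>
  define U where "U = {v \<in> sphere 0 1. \<bar>M\<bar> * (1 - z \<bullet> v) < 2 * \<eta>\<^sup>2}"
  have "open {v. \<bar>M\<bar> * (1 - z \<bullet> v) < 2 * \<eta>\<^sup>2}"
    by (intro open_Collect_less continuous_intros)
  moreover have "U = sphere 0 1 \<inter> {v. \<bar>M\<bar> * (1 - z \<bullet> v) < 2 * \<eta>\<^sup>2}"
    by (auto simp: U_def)
  ultimately have "openin (top_of_set (sphere 0 1)) U" by (simp add: openin_open_Int)
  moreover have "z \<in> U"
    using z(2) \<eta> by (simp add: U_def power2_norm_eq_inner[symmetric])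
  ultimately obtain T where T: "\<And>X t. solution_in (Q_field p 1) (sphere 0 1) X \<Longrightarrow> X 0 \<in> E \<Longrightarrow> T \<le> t \<Longrightarrow> X t \<in> U"
    using synchronization_uniform_attraction[OF sync E] by metis
  have ab: "(cmod a)\<^sup>2 + (cmod b)\<^sup>2 = 1" using z by (simp add: norm_hopf)
  \<comment> \<open>The flow is used only for masses above \<open>\<eta>\<^sup>2\<close>, where
    \<tau> \<ge> \<open>\<bar>T\<bar> / \<eta>\<^sup>2\<close> makes the rescaled time at least
    \<open>T\<close>. The absolute value keeps \<tau> nonnegative.\<close>
  have "cmod (b * A1 \<tau> - a * A2 \<tau>) \<le> \<eta>"
    if A: "solves_profile_ODE p q A1 A2"
      and cone: "hopf (A1 0) (A2 0) \<in> {k *\<^sub>R e | k e. e \<in> E \<and> 0 \<le> k}"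
      and M: "(cmod (A1 0))\<^sup>2 + (cmod (A2 0))\<^sup>2 \<le> M" and \<tau>: "\<bar>T\<bar> / \<eta>\<^sup>2 \<le> \<tau>" for A1 A2 \<tau>
  proof -
    define \<rho> where "\<rho> = (cmod (A1 0))\<^sup>2 + (cmod (A2 0))\<^sup>2"
    define h where "h = hopf (A1 \<tau>) (A2 \<tau>)"
    have mass: "(cmod (A1 \<tau>))\<^sup>2 + (cmod (A2 \<tau>))\<^sup>2 = \<rho>"
      using profile_mass_const[OF A] by (simp add: \<rho>_def)
    have h: "norm h = \<rho>" by (simp add: h_def norm_hopf mass)
    have sq: "2 * (cmod (b * A1 \<tau> - a * A2 \<tau>))\<^sup>2 = \<rho> - z \<bullet> h"
      by (simp add: cmod_cross_sq ab mass z(1) h_def)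
    have "(cmod (b * A1 \<tau> - a * A2 \<tau>))\<^sup>2 \<le> \<eta>\<^sup>2"
      \<comment> \<open>The time scale of the flow is \<open>1 / \<rho>\<close>, so attraction is not uniform as \<open>\<rho>\<close> tends to 0; for
        small \<open>\<rho>\<close> the conserved mass alone gives the bound.\<close>
    proof (cases "\<rho> \<le> \<eta>\<^sup>2")
      case True
      have "- (z \<bullet> h) \<le> \<rho>"
        using norm_cauchy_schwarz[of "- z" h] z(2) h by simp
      then show ?thesis using sq True by linarith
    next
      case False
      then have \<rho>0: "0 < \<rho>" using \<eta> by (smt (verit) zero_le_power2)
      \<comment> \<open>As \<open>e\<close> is a unit vector, the scalar \<open>k\<close> must be
        the mass, so the normalized trajectory starts at \<open>e\<close>.\<close>
      obtain k e where ke: "hopf (A1 0) (A2 0) = k *\<^sub>R e" "e \<in> E" "0 \<le> k" using cone by auto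
      have "norm e = 1" using ke(2) E(2) by auto
      then have "k = \<rho>" using arg_cong[OF ke(1), of norm] ke(3) by (simp add: norm_hopf \<rho>_def)
      define Y where "Y s = (1 / \<rho>) *\<^sub>R hopf (A1 (s / \<rho>)) (A2 (s / \<rho>))" for s
      have Y: "solution_in (Q_field p 1) (sphere 0 1) Y"
        unfolding Y_def using normalized_profile_solution[OF A \<rho>_def \<rho>0] .
      have "Y 0 \<in> E" using ke \<open>k = \<rho>\<close> \<rho>0 by (simp add: Y_def)
      moreover have "T \<le> \<rho> * \<tau>"
      proof -
        have "0 \<le> \<tau>" using \<tau> by (meson abs_ge_zero divide_nonneg_nonneg order_trans zero_le_power2)
        have "\<bar>T\<bar> \<le> \<eta>\<^sup>2 * \<tau>" using \<tau> \<eta> by (simp add: pos_divide_le_eq mult.commute)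
        also have "\<dots> \<le> \<rho> * \<tau>" using False \<open>0 \<le> \<tau>\<close> by (intro mult_right_mono) auto
        finally show ?thesis by linarith
      qed
      ultimately have "Y (\<rho> * \<tau>) \<in> U" using T Y by blast
      moreover have "Y (\<rho> * \<tau>) = (1 / \<rho>) *\<^sub>R h" using \<rho>0 by (simp add: Y_def h_def)
      ultimately have u: "\<bar>M\<bar> * (1 - z \<bullet> h / \<rho>) < 2 * \<eta>\<^sup>2" by (simp add: U_def)
      have "z \<bullet> h \<le> \<rho>" using norm_cauchy_schwarz[of z h] z(2) h by simp
      then have "0 \<le> 1 - z \<bullet> h / \<rho>" using \<rho>0 by simp
      then have "\<rho> * (1 - z \<bullet> h / \<rho>) \<le> \<bar>M\<bar> * (1 - z \<bullet> h / \<rho>)"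
        using M by (intro mult_right_mono) (auto simp: \<rho>_def)
      moreover have "\<rho> * (1 - z \<bullet> h / \<rho>) = \<rho> - z \<bullet> h" using \<rho>0 by (simp add: right_diff_distrib)
      ultimately show ?thesis using u sq by linarith
    qed
    then show ?thesis by (rule power2_le_imp_le) (use \<eta> in simp)
  qed
  then show ?thesis by (intro exI[of _ "\<bar>T\<bar> / \<eta>\<^sup>2"] allI impI)
qed

section \<open>Essential suprema and rays\<close>

text \<open>Dilations preserve null sets, because Lebesgue measure is its own image under a dilation
  up to a constant density.\<close>

lemma AE_lebesgue_scale:
  fixes c :: real
  assumes c: "c \<noteq> 0" and P: "AE x in lebesgue. P x"
  shows "AE x in lebesgue. P (c * x)"
proof -
  have meas: "(\<lambda>x. 0 + c * x) \<in> lebesgue \<rightarrow>\<^sub>M (lebesgue :: real measure)"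
    using lebesgue_affine_measurable[of "\<lambda>_::real. c" 0] c by simp
  have "AE x in density (distr lebesgue lebesgue (\<lambda>x. 0 + c * x)) (\<lambda>_. ennreal \<bar>c\<bar>). P x"
    using P by (subst lebesgue_real_affine[OF c, of 0, symmetric])
  then have "AE x in distr lebesgue lebesgue (\<lambda>x. 0 + c * x). P x"
    using c by (simp add: AE_density del: add_0)
  then have "AE x in lebesgue. P (0 + c * x)" by (rule AE_distrD[OF meas])
  then show ?thesis by simp
qed

text \<open>Away from its apex the cone over \<open>E\<close> is the preimage of the closed set
  \<open>E\<close> under normalization. Measurability is needed to treat a property almost
  everywhere on this set as a conditional property on the line.\<close>

lemma Omega_set_measurable:
  assumes \<alpha>: "\<alpha>1 \<in> borel_measurable lebesgue" "\<alpha>2 \<in> borel_measurable lebesgue"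
    and E: "closed E" "E \<subseteq> sphere 0 1"
  shows "Omega_set \<alpha>1 \<alpha>2 E \<in> sets lebesgue"
proof -
  \<comment> \<open>At \<open>v = 0\<close> the quotient is 0 by convention and the normalized
    vector is 0, which is not in \<open>E\<close>. The apex therefore has a disjunct of its own,
    present only if \<open>E\<close> is nonempty.\<close>
  have cone: "v \<in> {k *\<^sub>R e | k e. e \<in> E \<and> 0 \<le> k} \<longleftrightarrow> (E \<noteq> {} \<and> v = 0) \<or> (1 / norm v) *\<^sub>R v \<in> E" for v :: "real^3"
  proof (intro iffI)
    assume "v \<in> {k *\<^sub>R e | k e. e \<in> E \<and> 0 \<le> k}"
    then obtain k e where ke: "v = k *\<^sub>R e" "e \<in> E" "0 \<le> k" by auto
    moreover have "norm e = 1" using ke E by auto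
    ultimately show "(E \<noteq> {} \<and> v = 0) \<or> (1 / norm v) *\<^sub>R v \<in> E"
      by (cases "k = 0") auto
  next
    assume "(E \<noteq> {} \<and> v = 0) \<or> (1 / norm v) *\<^sub>R v \<in> E"
    then show "v \<in> {k *\<^sub>R e | k e. e \<in> E \<and> 0 \<le> k}"
    proof
      assume "E \<noteq> {} \<and> v = 0"
      then obtain e where "e \<in> E" "v = 0 *\<^sub>R e" by auto
      then show ?thesis by blast
    next
      assume *: "(1 / norm v) *\<^sub>R v \<in> E"
      moreover have "v \<noteq> 0" using * E(2) by auto
      then have "v = norm v *\<^sub>R ((1 / norm v) *\<^sub>R v)" by simp
      ultimately show ?thesis by (metis (mono_tags, lifting) mem_Collect_eq norm_ge_zero)
    qed
  qed
  define H where "H \<xi> = hopf (\<alpha>1 \<xi>) (\<alpha>2 \<xi>)" for \<xi>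
  have [measurable]: "\<alpha>1 \<in> borel_measurable lebesgue" "\<alpha>2 \<in> borel_measurable lebesgue" by fact+
  have Hm: "H \<in> borel_measurable lebesgue"
  proof -
    show ?thesis
      \<comment> \<open>The triple is expanded in basis vectors so that measurability of sums and
        multiples applies.\<close>
      unfolding H_def hopf_def vector_3_eq_sum_axis times_complex.sel cnj.sel
      by (intro borel_measurable_add borel_measurable_scaleR borel_measurable_const; measurable)
  qed
  have "{v :: real^3. (E \<noteq> {} \<and> v = 0) \<or> (1 / norm v) *\<^sub>R v \<in> E} \<in> sets borel"
  proof -
    have [measurable]: "E \<in> sets borel" using E(1) by (rule borel_closed)
    show ?thesis by measurable
  qed
  then have "H -` {v :: real^3. (E \<noteq> {} \<and> v = 0) \<or> (1 / norm v) *\<^sub>R v \<in> E} \<inter> space lebesgue \<in> sets lebesgue"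
    using Hm by (rule measurable_sets[rotated])
  moreover have "Omega_set \<alpha>1 \<alpha>2 E = H -` {v :: real^3. (E \<noteq> {} \<and> v = 0) \<or> (1 / norm v) *\<^sub>R v \<in> E} \<inter> space lebesgue"
    unfolding Omega_set_def H_def cone[symmetric] hopf_def by auto
  ultimately show ?thesis by simp
qed

lemma Linf_norm_leI:
  assumes "S \<in> sets lebesgue" "f \<in> borel_measurable lebesgue"
    and "AE x in lebesgue. x \<in> S \<longrightarrow> norm (f x) \<le> c"
  shows "Linf_norm S f \<le> ennreal c"
  unfolding Linf_norm_def
proof (rule esssup_I)
  have "(\<lambda>x. ennreal (norm (f x))) \<in> borel_measurable lebesgue" using assms(2) by measurable
  then show "(\<lambda>x. ennreal (norm (f x))) \<in> borel_measurable (restrict_space lebesgue S)"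
    by (rule measurable_restrict_space1)
  show "AE x in restrict_space lebesgue S. ennreal (norm (f x)) \<le> ennreal c"
    using assms(1,3) by (subst AE_restrict_space_iff) (auto elim!: eventually_mono intro: ennreal_leI)
qed

text \<open>The maximum appears because \<open>ennreal\<close> sends negative reals to 0, and the
  constant in the asymptotics has no prescribed sign.\<close>

lemma Linf_norm_UNIV_leD:
  assumes "Linf_norm UNIV f \<le> ennreal c"
  shows "AE x in lebesgue. norm (f x) \<le> max 0 c"
proof -
  have "AE x in lebesgue. ennreal (norm (f x)) \<le> Linf_norm UNIV f"
    using esssup_AE[where M=lebesgue] unfolding Linf_norm_def lebesgue_on_UNIV_eq .
  then show ?thesis
  proof eventually_elim
    case (elim x)
    then have "ennreal (norm (f x)) \<le> ennreal c" using assms by (rule order_trans)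
    then show ?case by (cases "0 \<le> c") (auto simp: ennreal_neg max_def)
  qed
qed

lemma in_Linf_AE_bounded:
  assumes "in_Linf f"
  obtains K where "AE x in lebesgue. norm (f x) \<le> K"
proof -
  have "Linf_norm UNIV f < top" using assms by (simp add: in_Linf_def)
  then obtain r where "Linf_norm UNIV f \<le> ennreal r"
    by (metis enn2real_positive_iff ennreal_enn2real order_refl)
  then show ?thesis using Linf_norm_UNIV_leD that by blast
qed

text \<open>This is the case \<beta> = 0 along x = 2 t \<xi>, where the profile depends on \<xi>
  alone at a fixed time. The weighted error is of order t^(-1/4 + \<delta>), which tends to 0
  because \<delta> < 1/4.\<close>

lemma asymptotics_on_rays:
  assumes A: "has_asymptotics \<epsilon> \<delta> u A" and \<delta>: "\<delta> < 1/4" and r: "0 < r"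
  shows "\<forall>\<^sub>F t in at_top. AE \<xi> in lebesgue.
    sqrt t * norm (u t (2 * t * \<xi>) - (2 * \<i> * of_real t) powr (-1/2) *
      exp (\<i> * of_real ((2 * t * \<xi>)\<^sup>2 / (4 * t))) * A (ln t / 2) \<xi>) \<le> r"
proof -
  let ?f = "\<lambda>t x. u t x - (2 * \<i> * of_real t) powr (-1/2) *
    exp (\<i> * of_real (x\<^sup>2 / (4 * t))) * A (ln t / 2) (x / (2 * t))"
  obtain C where C: "\<forall>\<^sub>F t in at_top. Linf_norm UNIV (?f t) \<le> ennreal (C * \<epsilon> * t powr (-3/4 + \<delta>))"
    using A[unfolded has_asymptotics_def, rule_format, of 0] by auto
  have "((\<lambda>t. \<bar>C * \<epsilon>\<bar> * t powr (-1/4 + \<delta>)) \<longlongrightarrow> \<bar>C * \<epsilon>\<bar> * 0) at_top"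
    using \<delta> by (intro tendsto_intros tendsto_neg_powr filterlim_ident) simp
  then have "\<forall>\<^sub>F t in at_top. \<bar>C * \<epsilon>\<bar> * t powr (-1/4 + \<delta>) < r"
    using r by (intro order_tendstoD(2)) auto
  then show ?thesis using C eventually_gt_at_top[of 0]
  proof eventually_elim
    case (elim t)
    have "sqrt t * t powr (-3/4 + \<delta>) = t powr (-1/4 + \<delta>)"
      using elim by (simp add: powr_half_sqrt[symmetric] powr_add[symmetric])
    then have "sqrt t * (\<bar>C * \<epsilon>\<bar> * t powr (-3/4 + \<delta>)) \<le> r"
      using elim(1) unfolding mult.left_commute[of "sqrt t"] by simp
    moreover have "max 0 (C * \<epsilon> * t powr (-3/4 + \<delta>)) \<le> \<bar>C * \<epsilon>\<bar> * t powr (-3/4 + \<delta>)"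
      by (auto intro: mult_right_mono)
    ultimately have bound: "sqrt t * max 0 (C * \<epsilon> * t powr (-3/4 + \<delta>)) \<le> r"
      using elim by (meson mult_left_mono order_trans real_sqrt_ge_zero less_imp_le)
    have "AE x in lebesgue. norm (?f t x) \<le> max 0 (C * \<epsilon> * t powr (-3/4 + \<delta>))"
      using elim(2) by (rule Linf_norm_UNIV_leD)
    then have "AE \<xi> in lebesgue. norm (?f t (2 * t * \<xi>)) \<le> max 0 (C * \<epsilon> * t powr (-3/4 + \<delta>))"
      using elim(3) by (intro AE_lebesgue_scale) auto
    then show ?case
    proof eventually_elim
      case (elim \<xi>)
      then have "sqrt t * norm (?f t (2 * t * \<xi>)) \<le> r"
        using bound \<open>0 < t\<close> by (meson mult_left_mono order_trans real_sqrt_ge_zero less_imp_le)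
      then show ?case using \<open>0 < t\<close> by simp
    qed
  qed
qed

text \<open>The phase is unimodular and the power has modulus 1 / sqrt (2 t), so the product is in
  fact 1 / sqrt 2.\<close>

lemma sqrt_norm_wave_factor:
  assumes "0 < t"
  shows "sqrt t * norm ((2 * \<i> * of_real t) powr (-1/2) * exp (\<i> * of_real \<theta>)) \<le> 1"
proof -
  have "norm ((2 * \<i> * of_real t) powr (-1/2)) = (2 * t) powr (-1/2)"
    using norm_powr_real_powr'[of "-1/2" "2 * \<i> * of_real t"] assms by (simp add: norm_mult)
  also have "\<dots> = 1 / sqrt (2 * t)"
    using assms powr_minus_divide[of "2 * t" "1/2"] by (simp add: powr_half_sqrt)
  finally show ?thesis using assms by (simp add: norm_mult real_sqrt_mult)
qed

text \<open>Both components carry the same wave factor \<open>G\<close>, so the combination of the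
  leading terms is \<open>G\<close> times that of the profiles. Two remainders and this term
  contribute at most \<open>r\<close> each.\<close>

lemma norm_combination_le:
  fixes u1 u2 a b G v1 v2 :: complex
  assumes "norm a \<le> 1" "norm b \<le> 1" "0 \<le> s" "s * norm G \<le> 1"
    and "s * norm (u1 - G * v1) \<le> r" "s * norm (u2 - G * v2) \<le> r" "norm (b * v1 - a * v2) \<le> r"
  shows "s * norm (b * u1 + (- a) * u2) \<le> 3 * r"
proof -
  have "b * u1 + (- a) * u2 = b * (u1 - G * v1) - a * (u2 - G * v2) + G * (b * v1 - a * v2)"
    by (simp add: algebra_simps)
  then have "norm (b * u1 + (- a) * u2) \<le> norm (b * (u1 - G * v1) - a * (u2 - G * v2)) + norm (G * (b * v1 - a * v2))"
    by (simp only: norm_triangle_ineq)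
  also have "\<dots> \<le> norm b * norm (u1 - G * v1) + norm a * norm (u2 - G * v2) + norm G * norm (b * v1 - a * v2)"
    using norm_triangle_ineq4[of "b * (u1 - G * v1)" "a * (u2 - G * v2)"] by (simp add: norm_mult)
  also have "\<dots> \<le> norm (u1 - G * v1) + norm (u2 - G * v2) + norm G * norm (b * v1 - a * v2)"
    using assms(1,2) by (intro add_mono order_refl mult_left_le_one_le) auto
  finally have "s * norm (b * u1 + (- a) * u2) \<le>
      s * (norm (u1 - G * v1) + norm (u2 - G * v2) + norm G * norm (b * v1 - a * v2))"
    using assms(3) by (rule mult_left_mono)
  also have "\<dots> = s * norm (u1 - G * v1) + s * norm (u2 - G * v2) + (s * norm G) * norm (b * v1 - a * v2)"
    by (simp add: algebra_simps)
  also have "\<dots> \<le> r + r + 1 * r"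
    using assms by (intro add_mono mult_mono) auto
  finally show ?thesis by simp
qed

section \<open>Choice of the combination and decay of the solution\<close>

theorem theorem1p8:
  fixes p :: "real^5" and q :: "real^3" and pinf :: "real^3"
  assumes "p$1 \<ge> 0" and "p$3 \<ge> 0" and "p$5 \<ge> 0" and "p \<noteq> 0"
    and "nonlinear_synchronization p 1 pinf"
  shows "\<exists>\<gamma>1 \<gamma>2 :: complex. (\<gamma>1, \<gamma>2) \<noteq> (0, 0) \<and>
    (\<forall>(\<delta>0 :: real) (\<epsilon>0 :: real \<Rightarrow> real) u1 u2 \<alpha>1 \<alpha>2 E.
      0 < \<delta>0 \<and> \<delta>0 < 1/4 \<and> (\<forall>\<delta>\<in>{0<..<\<delta>0}. 0 < \<epsilon>0 \<delta>) \<and>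
      small_data_solution p q \<delta>0 \<epsilon>0 u1 u2 \<alpha>1 \<alpha>2 \<and>
      closed E \<and> E \<subseteq> sphere 0 1 - (Q_fixed_points p 1 - {pinf}) \<longrightarrow>
      ((\<lambda>t. ennreal (sqrt t) *
            Linf_norm (Omega_set \<alpha>1 \<alpha>2 E) (\<lambda>\<xi>. \<gamma>1 * u1 t (2 * t * \<xi>) + \<gamma>2 * u2 t (2 * t * \<xi>)))
        \<longlongrightarrow> 0) at_top)"
proof -
  have sphere: "pinf \<in> sphere 0 1"
    using assms(5) by (simp add: nonlinear_synchronization_def Q_fixed_points_def)
  \<comment> \<open>The pair depends on \<open>pinf\<close> alone, so it is fixed before any
    solution or set \<open>E\<close> is considered.\<close>
  then obtain a b where ab: "hopf a b = pinf" by (rule hopf_surj_on_sphere)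
  have norm_ab: "(cmod a)\<^sup>2 + (cmod b)\<^sup>2 = 1" using sphere norm_hopf[of a b] ab by simp
  have a1: "cmod a \<le> 1" and b1: "cmod b \<le> 1"
    using norm_ab by (smt (verit) power2_le_imp_le power_one zero_le_power2)+
  show ?thesis
  proof (rule exI[of _ b], rule exI[of _ "- a"], rule conjI; (intro allI impI; elim conjE)?)
    show "(b, - a) \<noteq> (0, 0)" using norm_ab by auto
  next
    fix \<delta>0 :: real and \<epsilon>0 :: "real \<Rightarrow> real" and u1 u2 \<alpha>1 \<alpha>2 E
    assume "\<delta>0 < 1/4" and sol: "small_data_solution p q \<delta>0 \<epsilon>0 u1 u2 \<alpha>1 \<alpha>2"
      and E: "closed E" "E \<subseteq> sphere 0 1 - (Q_fixed_points p 1 - {pinf})"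
    obtain \<delta> \<epsilon> where "\<delta> < \<delta>0" and assoc: "associated_functions p q \<epsilon> \<delta> u1 u2 \<alpha>1 \<alpha>2"
      using sol by (auto simp: small_data_solution_def Let_def)
    then have \<delta>: "\<delta> < 1/4" using \<open>\<delta>0 < 1/4\<close> by linarith
    obtain A1 A2 where A: "\<And>\<xi>. solves_profile_ODE p q (\<lambda>\<tau>. A1 \<tau> \<xi>) (\<lambda>\<tau>. A2 \<tau> \<xi>)"
        "\<And>\<xi>. A1 0 \<xi> = \<alpha>1 \<xi>" "\<And>\<xi>. A2 0 \<xi> = \<alpha>2 \<xi>"
        "has_asymptotics \<epsilon> \<delta> u1 A1" "has_asymptotics \<epsilon> \<delta> u2 A2"
      using assoc unfolding associated_functions_def by blast
    have Linf: "in_Linf \<alpha>1" "in_Linf \<alpha>2" using assoc by (simp_all add: associated_functions_def)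
    have \<Omega>: "Omega_set \<alpha>1 \<alpha>2 E \<in> sets lebesgue"
      using Linf E by (intro Omega_set_measurable) (auto simp: in_Linf_def)
    obtain K1 where K1: "AE \<xi> in lebesgue. norm (\<alpha>1 \<xi>) \<le> K1"
      using Linf(1) by (rule in_Linf_AE_bounded)
    obtain K2 where K2: "AE \<xi> in lebesgue. norm (\<alpha>2 \<xi>) \<le> K2"
      using Linf(2) by (rule in_Linf_AE_bounded)
    \<comment> \<open>This essential bound on the mass makes the synchronization time common to
      almost all frequencies.\<close>
    have bounded: "AE \<xi> in lebesgue. (cmod (\<alpha>1 \<xi>))\<^sup>2 + (cmod (\<alpha>2 \<xi>))\<^sup>2 \<le> K1\<^sup>2 + K2\<^sup>2"
      using K1 K2 by eventually_elim (intro add_mono power_mono, auto)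
    have meas: "(\<lambda>\<xi>. b * u1 t (2 * t * \<xi>) + (- a) * u2 t (2 * t * \<xi>)) \<in> borel_measurable lebesgue" for t
    proof -
      have "continuous_on UNIV (u1 t)" "continuous_on UNIV (u2 t)"
        using sol unfolding small_data_solution_def solves_NLS_def
        by (auto intro!: continuous_at_imp_continuous_on differentiable_imp_continuous_within)
      moreover have "continuous_on UNIV (\<lambda>\<xi>. 2 * t * \<xi>)"
        by (intro continuous_intros)
      ultimately have "continuous_on UNIV (\<lambda>\<xi>. u1 t (2 * t * \<xi>))" "continuous_on UNIV (\<lambda>\<xi>. u2 t (2 * t * \<xi>))"
        by (auto intro: continuous_on_compose2)
      then have "continuous_on UNIV (\<lambda>\<xi>. b * u1 t (2 * t * \<xi>) + (- a) * u2 t (2 * t * \<xi>))"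
        by (rule continuous_on_add[OF continuous_on_mult_left continuous_on_mult_left])
      then show ?thesis
        by (simp add: borel_measurable_continuous_onI measurable_completion)
    qed
    show "((\<lambda>t. ennreal (sqrt t) *
        Linf_norm (Omega_set \<alpha>1 \<alpha>2 E) (\<lambda>\<xi>. b * u1 t (2 * t * \<xi>) + (- a) * u2 t (2 * t * \<xi>))) \<longlongrightarrow> 0) at_top"
    proof (rule order_tendstoI)
      fix y :: ennreal assume "0 < y"
      \<comment> \<open>An intermediate value is finite even for infinite \<open>y\<close>, and it
        leaves room for the strict inequality.\<close>
      then obtain z where z: "0 < z" "z < y" using dense by blast
      then obtain r where r: "z = ennreal r" "0 < r" by (cases z) (auto simp: top_unique)
      have "0 < r / 3" using r by simp
      have norm_pinf: "norm pinf = 1" using sphere by simp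
      obtain T where T: "\<forall>B1 B2 \<tau>. solves_profile_ODE p q B1 B2 \<longrightarrow>
          hopf (B1 0) (B2 0) \<in> {k *\<^sub>R e | k e. e \<in> E \<and> 0 \<le> k} \<longrightarrow>
          (cmod (B1 0))\<^sup>2 + (cmod (B2 0))\<^sup>2 \<le> K1\<^sup>2 + K2\<^sup>2 \<longrightarrow> T \<le> \<tau> \<longrightarrow>
          cmod (b * B1 \<tau> - a * B2 \<tau>) \<le> r / 3"
        using profile_combination_uniformly_small[OF assms(5) E ab[symmetric] norm_pinf \<open>0 < r / 3\<close>]
        by (rule exE)
      note asym = asymptotics_on_rays[OF A(4) \<delta> \<open>0 < r / 3\<close>] asymptotics_on_rays[OF A(5) \<delta> \<open>0 < r / 3\<close>]
      show "\<forall>\<^sub>F t in at_top. ennreal (sqrt t) *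
          Linf_norm (Omega_set \<alpha>1 \<alpha>2 E) (\<lambda>\<xi>. b * u1 t (2 * t * \<xi>) + (- a) * u2 t (2 * t * \<xi>)) < y"
        \<comment> \<open>The profile is evaluated at time \<open>ln t / 2\<close>, which is at
          least \<open>T\<close> from \<open>exp (2 * T)\<close> on.\<close>
        using asym eventually_ge_at_top[of "exp (2 * T)"]
      proof eventually_elim
        case (elim t)
        have t: "0 < t" using elim(3) by (smt (verit) exp_gt_zero)
        then have \<tau>: "T \<le> ln t / 2" using elim(3) ln_ge_iff[of t "2 * T"] by simp
        have "AE \<xi> in lebesgue. \<xi> \<in> Omega_set \<alpha>1 \<alpha>2 E \<longrightarrow>
            norm (b * u1 t (2 * t * \<xi>) + (- a) * u2 t (2 * t * \<xi>)) \<le> r / sqrt t"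
          using elim(1,2) bounded
        proof eventually_elim
          case (elim \<xi>)
          show ?case
          proof
            assume "\<xi> \<in> Omega_set \<alpha>1 \<alpha>2 E"
            then have "hopf (A1 0 \<xi>) (A2 0 \<xi>) \<in> {k *\<^sub>R e | k e. e \<in> E \<and> 0 \<le> k}"
              unfolding A(2,3) Omega_set_def hopf_def by (rule CollectD)
            moreover have "(cmod (A1 0 \<xi>))\<^sup>2 + (cmod (A2 0 \<xi>))\<^sup>2 \<le> K1\<^sup>2 + K2\<^sup>2"
              unfolding A(2,3) using elim(3) .
            ultimately have "cmod (b * A1 (ln t / 2) \<xi> - a * A2 (ln t / 2) \<xi>) \<le> r / 3"
              by (rule T[rule_format, OF A(1) _ _ \<tau>])
            then have "sqrt t * norm (b * u1 t (2 * t * \<xi>) + (- a) * u2 t (2 * t * \<xi>)) \<le> 3 * (r / 3)"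
              using t by (intro norm_combination_le[OF a1 b1 _ sqrt_norm_wave_factor[OF t] elim(1,2)]) auto
            then show "norm (b * u1 t (2 * t * \<xi>) + (- a) * u2 t (2 * t * \<xi>)) \<le> r / sqrt t"
              using t by (simp add: field_simps)
          qed
        qed
        then have "Linf_norm (Omega_set \<alpha>1 \<alpha>2 E)
            (\<lambda>\<xi>. b * u1 t (2 * t * \<xi>) + (- a) * u2 t (2 * t * \<xi>)) \<le> ennreal (r / sqrt t)"
          by (rule Linf_norm_leI[OF \<Omega> meas])
        then have "ennreal (sqrt t) * Linf_norm (Omega_set \<alpha>1 \<alpha>2 E)
            (\<lambda>\<xi>. b * u1 t (2 * t * \<xi>) + (- a) * u2 t (2 * t * \<xi>)) \<le> ennreal (sqrt t) * ennreal (r / sqrt t)"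
          by (rule mult_left_mono) simp
        also have "\<dots> = z" using t r by (simp add: ennreal_mult[symmetric])
        finally show ?case using z(2) by (rule le_less_trans)
      qed
    qed simp
  qed
qed

end
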